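(* Let $\mathbf{N}=(N_p)_{p\in\mathbb{N}_0}\in\mathcal{LC}$ have quotients $\nu_k:=N_k/N_{k-1}$ ($k\ge 1$) and assume that $$\exists\,Q\in\mathbb{N}:\quad 1<\liminf_{j\to\infty}\frac{\nu_{Qj}}{\nu_j}\qquad\text{and}\qquad \sup_{j\ge 1}\frac{\nu_{2j}}{\nu_j}<+\infty .$$ Then there exists a sequence $\mathbf{M}=(M_p)_{p\in\mathbb{N}_0}\in\mathcal{LC}$, with quotients $\mu_k:=M_k/M_{k-1}$ ($k\geq 1$), such that: (a) the associated function $\omega_{\mathbf{M}}$ is a general weight function; (b) $1<\liminf_{j\to\infty}\frac{\mu_{Qj}}{\mu_j}\le\limsup_{j\to\infty}\frac{\mu_{Qj}}{\mu_j}<+\infty$ for some integer $Q\ge 2$, and $\mathbf{M}$ has moderate growth, i.e. there is $C\ge 1$ with $M_{p+q}\le C^{p+q}M_pM_q$ for all $p,q\in\mathbb{N}_0$; (c) $\liminf_{p\to\infty}\left(\frac{M_p}{N_p}\right)^{1/p}=0$ and $\limsup_{p\to\infty}\left(\frac{M_p}{N_p}\right)^{1/p}=+\infty$; consequently neither $\mathbf{M}\preceq\mathbf{N}$ nor $\mathbf{N}\preceq\mathbf{M}$ holds.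
   Context: $\mathbb{N}_0=\mathbb{N}\cup\{0\}$. $\mathcal{LC}$ is the set of sequences $\mathbf{M}=(M_p)_{p\in\mathbb{N}_0}$ of positive reals that are normalized ($M_1\ge M_0=1$), log-convex ($M_p^2\le M_{p-1}M_{p+1}$ for $p\ge 1$) and satisfy $\lim_{p\to\infty}(M_p)^{1/p}=\infty$. The associated function is $\omega_{\mathbf{M}}(t)=\sup_{p\in\mathbb{N}_0}\log\frac{|t|^p}{M_p}$, $t\in\mathbb{R}$, with $0^0:=1$ and $\log 0:=-\infty$ (considered here on $[0,+\infty)$). A general weight function is a continuous increasing (i.e. nondecreasing) function $\omega:[0,+\infty)\to[0,+\infty)$ such that: $(\alpha)$ there is $L\ge 1$ with $\omega(2t)\le L(\omega(t)+1)$ for all $t\ge 0$; $(\gamma)$ $\log t=o(\omega(t))$ as $t\to+\infty$; $(\delta)$ $t\mapsto\omega(e^t)$ is convex on $[0,+\infty)$. $\mathbf{M}\preceq\mathbf{N}$ means: there is $C\ge 1$ with $M_p\le C^pN_p$ for all $p\in\mathbb{N}_0$. *)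

theory Defs
  imports "HOL-Analysis.Analysis" "HOL-Library.Landau_Symbols"
begin

definition LC :: "(nat \<Rightarrow> real) set" where
  "LC = {M. (\<forall>p. M p > 0) \<and> M 0 = 1 \<and> M 1 \<ge> M 0 \<and>
            (\<forall>p\<ge>1. (M p)\<^sup>2 \<le> M (p - 1) * M (p + 1)) \<and>
            filterlim (\<lambda>p. M p powr (1 / real p)) at_top sequentially}"

text \<open>Only meaningful for \<open>k \<ge> 1\<close>; truncated subtraction gives \<open>quot M 0 = M 0 / M 0\<close>,
  a value that is never used.\<close>

definition quot :: "(nat \<Rightarrow> real) \<Rightarrow> nat \<Rightarrow> real" where
  "quot M k = M k / M (k - 1)"

text \<open>The logarithm on \<open>[0,\<infinity>)\<close> with the convention \<open>log 0 = -\<infinity>\<close>; the library has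
  \<open>ln 0 = 0\<close> on the reals.\<close>

definition elog :: "real \<Rightarrow> ereal" where
  "elog x = (if x = 0 then -\<infinity> else ereal (ln x))"

definition assoc_fun :: "(nat \<Rightarrow> real) \<Rightarrow> real \<Rightarrow> ereal" where
  "assoc_fun M t = (SUP p. elog (\<bar>t\<bar> ^ p / M p))"

text \<open>A function on \<open>[0,\<infinity>)\<close> is represented by a total function on the reals of which only
  the restriction to \<open>{0..}\<close> matters.\<close>

definition general_weight_function :: "(real \<Rightarrow> real) \<Rightarrow> bool" where
  "general_weight_function \<omega> \<longleftrightarrow>
     (\<forall>t\<ge>0. \<omega> t \<ge> 0) \<and>
     continuous_on {0..} \<omega> \<and>
     mono_on {0..} \<omega> \<and>
     (\<exists>L\<ge>1. \<forall>t\<ge>0. \<omega> (2 * t) \<le> L * (\<omega> t + 1)) \<and>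
     (\<lambda>t. ln t) \<in> o[at_top](\<omega>) \<and>
     convex_on {0..} (\<lambda>t. \<omega> (exp t))"

definition moderate_growth :: "(nat \<Rightarrow> real) \<Rightarrow> bool" where
  "moderate_growth M \<longleftrightarrow> (\<exists>C\<ge>1. \<forall>p q. M (p + q) \<le> C ^ (p + q) * M p * M q)"

definition preceq :: "(nat \<Rightarrow> real) \<Rightarrow> (nat \<Rightarrow> real) \<Rightarrow> bool" (infix \<open>\<preceq>\<close> 50) where
  "M \<preceq> N \<longleftrightarrow> (\<exists>C\<ge>1. \<forall>p. M p \<le> C ^ p * N p)"

end

theory Submission
  imports Defs
begin

text \<open>
  Two sequences are compared through the means over \<open>k \<le> p\<close> of \<open>ln (\<mu> k / \<nu> k)\<close>. To make these
  means oscillate between \<open>-\<infinity>\<close> and \<open>\<infinity>\<close> without harming the regularity of the quotients,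
  the quotients \<open>\<nu> k\<close> of \<open>N\<close> are multiplied by \<open>exp (s * osc (ln k))\<close>, where
  \<open>osc x = x * sin (ln (1 + x))\<close> is Lipschitz and unbounded in both directions. The conditions on
  the \<open>\<nu> k\<close> say that they grow at least like a power \<open>j powr \<epsilon>\<close> between any two indices
  (\<open>power_lower_bound\<close>) and satisfy a doubling condition. A factor of the form
  \<open>exp (Lipschitz function of ln k)\<close> changes growth exponents by at most the Lipschitz constant, so
  for \<open>s = \<epsilon> / 4\<close> the perturbed quotients still grow at least like \<open>j powr (\<epsilon> / 2)\<close>. They are
  almost increasing, and their running maximum \<open>\<mu>\<close> is increasing and comparable to them
  (\<open>oscillating_perturbation\<close>).

  The sequence \<open>M\<close> with quotients \<open>\<mu>\<close> inherits everything from the power bounds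
  (locale \<open>regular_quotients\<close>). Moderate growth results from the upper bound by a binomial
  coefficient. The weight function condition \<open>omega (2 t) = O(omega t + 1)\<close> results from
  the fact that \<open>omega t\<close> is the sum of the positive parts of \<open>ln (t / \<mu> k)\<close>: once
  \<open>\<mu> (Q * j) \<ge> 2 * \<mu> j\<close>, the terms for \<open>2 t\<close> are dominated, \<open>Q\<close> at a time, by those for \<open>t\<close>.

  Finally, because \<open>ln k\<close> for \<open>k \<le> p\<close> lies on average within \<open>1\<close> of \<open>ln p\<close>, the mean of
  \<open>s * osc (ln k)\<close> equals \<open>s * osc (ln p)\<close> up to a constant (\<open>average_osc_ln\<close>). Hence
  \<open>(M p / N p) powr (1 / p)\<close> is \<open>exp (s * osc (ln p))\<close> up to constant factors and has \<open>0\<close> and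
  \<open>\<infinity>\<close> as its extreme limits.
\<close>

section \<open>Power bounds for monotone sequences\<close>

text \<open>Iterating \<open>q * \<nu> j \<le> \<nu> (Q * j)\<close> along \<open>i, Q i, Q\<^sup>2 i, \<dots>\<close> and filling the gaps by
  monotonicity gives growth of order \<open>\<epsilon> = log Q q\<close>. The finitely many indices below \<open>j0\<close>
  cost only a constant factor. This form of the hypothesis, unlike the limes inferior,
  survives multiplication by a factor that varies more slowly than a power.\<close>

lemma power_lower_bound:
  fixes \<nu> :: "nat \<Rightarrow> real"
  assumes mono: "\<And>i j. 1 \<le> i \<Longrightarrow> i \<le> j \<Longrightarrow> \<nu> i \<le> \<nu> j"
    and pos: "\<And>i. 1 \<le> i \<Longrightarrow> 0 < \<nu> i"
    and Q: "2 \<le> Q" and q: "1 < q" and j0: "1 \<le> j0"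
    and step: "\<And>j. j0 \<le> j \<Longrightarrow> q * \<nu> j \<le> \<nu> (Q * j)"
  obtains \<epsilon> c :: real where "0 < \<epsilon>" "0 < c"
    "\<And>i j. 1 \<le> i \<Longrightarrow> i \<le> j \<Longrightarrow> c * (real j / real i) powr \<epsilon> * \<nu> i \<le> \<nu> j"
proof -
  define \<epsilon> where "\<epsilon> = log (real Q) q"
  have \<epsilon>: "0 < \<epsilon>" and Q\<epsilon>: "real Q powr \<epsilon> = q"
    using Q q by (auto simp: \<epsilon>_def)
  have far: "(real j / real i) powr \<epsilon> * \<nu> i \<le> q * \<nu> j" if "j0 \<le> i" "i \<le> j" for i j
    using that
  proof (induction "j - i" arbitrary: i rule: less_induct)
    case less
    have i: "1 \<le> i" using less.prems j0 by linarith
    show ?case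
    proof (cases "j < Q * i")
      case True
      have "real j / real i \<le> real Q"
        using True i by (simp add: field_simps flip: of_nat_mult)
      then have "(real j / real i) powr \<epsilon> \<le> q"
        unfolding Q\<epsilon>[symmetric] using \<epsilon> by (intro powr_mono2) auto
      then show ?thesis
        using pos[OF i] q mono[OF i less.prems(2)] by (intro mult_mono) auto
    next
      case False
      have "i < Q * i" using i Q by simp
      then have "(real j / real (Q * i)) powr \<epsilon> * \<nu> (Q * i) \<le> q * \<nu> j"
        using False less.prems \<open>i < Q * i\<close> by (intro less.hyps) linarith+
      moreover have "(real j / real i) powr \<epsilon> = (real j / real (Q * i)) powr \<epsilon> * q"
        using Q i by (simp flip: Q\<epsilon> powr_mult)
      moreover have "(real j / real (Q * i)) powr \<epsilon> * (q * \<nu> i)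
          \<le> (real j / real (Q * i)) powr \<epsilon> * \<nu> (Q * i)"
        by (intro mult_left_mono step less.prems) auto
      ultimately show ?thesis by (simp add: mult.assoc)
    qed
  qed
  define K where "K = q * real j0 powr \<epsilon>"
  have K: "0 < K" using q j0 by (simp add: K_def)
  have "(real j / real i) powr \<epsilon> * \<nu> i \<le> K * \<nu> j" if i: "1 \<le> i" and ij: "i \<le> j" for i j
  proof (cases "j0 \<le> j")
    case True
    define k where "k = max i j0"
    have k: "1 \<le> k" "i \<le> k" "j0 \<le> k" "k \<le> j" using i ij True by (auto simp: k_def)
    have "k \<le> i * j0" using i j0 by (auto simp: k_def max_def)
    then have "real k \<le> real i * real j0"
      by (metis of_nat_le_iff of_nat_mult)
    then have "real j * real k \<le> real j * (real i * real j0)"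
      by (intro mult_left_mono) auto
    then have "real j / real i \<le> real j0 * (real j / real k)"
      using i k by (simp add: field_simps)
    then have "(real j / real i) powr \<epsilon> \<le> (real j0 * (real j / real k)) powr \<epsilon>"
      using \<epsilon> by (intro powr_mono2) auto
    also have "\<dots> = real j0 powr \<epsilon> * (real j / real k) powr \<epsilon>"
      by (rule powr_mult)
    finally have "(real j / real i) powr \<epsilon> * \<nu> i
        \<le> (real j0 powr \<epsilon> * (real j / real k) powr \<epsilon>) * \<nu> k"
      using pos[OF i] mono[OF i k(2)] by (intro mult_mono) auto
    also have "\<dots> \<le> real j0 powr \<epsilon> * (q * \<nu> j)"
      unfolding mult.assoc by (intro mult_left_mono far k) auto
    finally show ?thesis by (simp add: K_def mult_ac)
  next
    case False
    have "j \<le> i * j0" using False i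
      by (metis One_nat_def Suc_leI le_trans linorder_not_less mult.commute mult_le_mono2 nat_less_le nat_mult_1_right)
    then have "real j / real i \<le> real j0"
      using i by (simp add: field_simps flip: of_nat_mult)
    then have "(real j / real i) powr \<epsilon> \<le> real j0 powr \<epsilon>"
      using \<epsilon> by (intro powr_mono2) auto
    also have "\<dots> \<le> K" using q by (simp add: K_def mult_le_cancel_right1)
    finally show ?thesis
      using pos[OF i] mono[OF i ij] K by (intro mult_mono) auto
  qed
  then show thesis
    using that[of \<epsilon> "1 / K"] \<epsilon> K by (simp add: field_simps)
qed

text \<open>The same iteration with \<open>Q = 2\<close> and the inequalities reversed. A natural exponent \<open>B\<close> is
  enough here and lets the bound be compared with powers of binomial coefficients.\<close>

lemma power_upper_bound:
  fixes \<mu> :: "nat \<Rightarrow> real"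
  assumes mono: "\<And>i j. 1 \<le> i \<Longrightarrow> i \<le> j \<Longrightarrow> \<mu> i \<le> \<mu> j"
    and pos: "\<And>i. 1 \<le> i \<Longrightarrow> 0 < \<mu> i"
    and doubling: "\<And>j. 1 \<le> j \<Longrightarrow> \<mu> (2 * j) \<le> 2 ^ B * \<mu> j"
    and "1 \<le> i" "i \<le> j"
  shows "\<mu> j \<le> (2 * (real j / real i)) ^ B * \<mu> i"
  using \<open>1 \<le> i\<close> \<open>i \<le> j\<close>
proof (induction "j - i" arbitrary: i rule: less_induct)
  case less
  show ?case
  proof (cases "j < 2 * i")
    case True
    have "\<mu> j \<le> \<mu> (2 * i)" using True less.prems by (intro mono) auto
    also have "\<dots> \<le> 2 ^ B * \<mu> i" by (rule doubling[OF less.prems(1)])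
    also have "\<dots> \<le> (2 * (real j / real i)) ^ B * \<mu> i"
      using less.prems pos[of i] by (intro mult_right_mono power_mono) (auto simp: field_simps)
    finally show ?thesis .
  next
    case False
    then have "\<mu> j \<le> (2 * (real j / real (2 * i))) ^ B * \<mu> (2 * i)"
      using less.prems by (intro less.hyps) auto
    also have "\<dots> \<le> (2 * (real j / real (2 * i))) ^ B * (2 ^ B * \<mu> i)"
      by (intro mult_left_mono doubling less.prems) auto
    also have "\<dots> = (2 * (real j / real i)) ^ B * \<mu> i"
      by (simp add: power_mult_distrib power_divide)
    finally show ?thesis .
  qed
qed

section \<open>Averages and oscillation on the logarithmic scale\<close>

text \<open>This is \<open>p ^ p \<le> exp p * fact p\<close> in logarithmic form: on average \<open>ln k\<close> lies at most \<open>1\<close>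
  below \<open>ln p\<close>. Hence a Lipschitz function of \<open>ln k\<close> differs from its own running mean by a
  bounded amount only.\<close>

lemma sum_ln_gap_le: "(\<Sum>k=1..p. ln (real p) - ln (real k)) \<le> real p"
proof (induction p)
  case (Suc p)
  show ?case
  proof (cases "p = 0")
    case False
    have "real p * (ln (real (Suc p)) - ln (real p)) \<le> 1"
    proof -
      have "ln (real (Suc p)) - ln (real p) = ln (1 + 1 / real p)"
        using False ln_div[of "real (Suc p)" "real p"] by (simp add: add_divide_distrib add.commute)
      also have "\<dots> \<le> 1 / real p" by (intro ln_add_one_self_le_self) simp
      finally show ?thesis using False by (simp add: field_simps)
    qed
    with Suc.IH show ?thesis
      by (simp add: sum_subtractf algebra_simps)
  qed simp
qed simp

text \<open>The second logarithm makes one period of the sine so long that the linear amplitude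
  keeps a bounded derivative.\<close>

definition osc :: "real \<Rightarrow> real" where
  "osc x = x * sin (ln (1 + x))"

lemma osc_lipschitz:
  assumes "0 \<le> x" "0 \<le> y"
  shows "\<bar>osc x - osc y\<bar> \<le> 2 * \<bar>x - y\<bar>"
proof -
  have "norm (osc x - osc y) \<le> 2 * norm (x - y)"
  proof (rule field_differentiable_bound)
    fix z :: real assume z: "z \<in> {0..}"
    show "(osc has_field_derivative sin (ln (1 + z)) + z / (1 + z) * cos (ln (1 + z)))
        (at z within {0..})"
      unfolding osc_def[abs_def] using z by (auto intro!: derivative_eq_intros)
    have "\<bar>z / (1 + z) * cos (ln (1 + z))\<bar> \<le> 1 * 1"
      unfolding abs_mult using z by (intro mult_mono) auto
    then have "norm (sin (ln (1 + z)) + z / (1 + z) * cos (ln (1 + z))) \<le> 1 + 1"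
      by (intro norm_triangle_mono) auto
    then show "norm (sin (ln (1 + z)) + z / (1 + z) * cos (ln (1 + z))) \<le> 2"
      by simp
  qed (use assms in auto)
  then show ?thesis by simp
qed

text \<open>The extrema of \<open>osc\<close> are not logarithms of integers; rounding \<open>exp x\<close> up moves its
  logarithm by at most \<open>1\<close>, which the Lipschitz bound turns into an error of at most \<open>2\<close>.\<close>

lemma osc_ln_unbounded:
  assumes s: "s = 1 \<or> s = (-1::real)"
  shows "\<exists>p\<ge>n. 1 \<le> p \<and> K \<le> s * osc (ln (real p))"
proof -
  \<comment> \<open>the point \<open>x\<close> chosen below is where the sine takes the value \<open>s\<close>\<close>
  define \<theta> where "\<theta> = (if s = 1 then pi / 2 else 3 * pi / 2)"
  obtain m :: nat where m: "real n + \<bar>K\<bar> + 2 \<le> real m" using real_arch_simple by blast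
  define x where "x = exp (\<theta> + 2 * pi * real m) - 1"
  have sin: "sin (\<theta> + 2 * pi * real m) = s"
  proof -
    have "sin (\<theta> + 2 * pi * real m) = sin \<theta>"
      using sin.plus_of_nat[of \<theta> m] by (simp add: mult_ac)
    also have "\<dots> = s" using s using sin_3over2_pi by (auto simp: \<theta>_def)
    finally show ?thesis .
  qed
  have "real m \<le> 2 * pi * real m" using pi_ge_two by (simp add: mult_le_cancel_right1)
  also have "\<dots> \<le> \<theta> + 2 * pi * real m" by (simp add: \<theta>_def)
  also have "\<dots> \<le> x"
    using exp_ge_add_one_self[of "\<theta> + 2 * pi * real m"] unfolding x_def by linarith
  finally have mx: "real m \<le> x" .
  have ln1x: "ln (1 + x) = \<theta> + 2 * pi * real m" by (simp add: x_def)
  have oscx: "s * osc x = x" using s by (auto simp: osc_def ln1x sin)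
  define p where "p = nat \<lceil>exp x\<rceil>"
  have p: "exp x \<le> real p" "real p \<le> exp x + 1" 
    using exp_gt_zero[of x] by (auto simp: p_def less_imp_le)
  have ppos: "1 \<le> p" using p(1) exp_gt_zero[of x] by linarith
  have "x \<le> ln (real p)" using p(1) ppos by (simp add: ln_ge_iff)
  moreover have "ln (real p) \<le> x + 1"
  proof -
    have "1 \<le> exp x" using mx m by simp
    moreover have "exp x * 2 \<le> exp x * exp 1"
      using exp_ge_add_one_self[of 1] by (intro mult_left_mono) auto
    ultimately have "real p \<le> exp x * exp 1" using p(2) by linarith
    then have "ln (real p) \<le> ln (exp x * exp 1)" using ppos by (intro ln_mono) auto
    then show ?thesis by (simp flip: exp_add)
  qed
  ultimately have "\<bar>osc (ln (real p)) - osc x\<bar> \<le> 2"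
    using osc_lipschitz[of "ln (real p)" x] mx m by simp
  then have "\<bar>s * osc (ln (real p)) - x\<bar> \<le> 2" using oscx s by auto
  then have "K \<le> s * osc (ln (real p))" using mx m by linarith
  moreover have "n \<le> p" using exp_ge_add_one_self[of x] p(1) mx m by linarith
  ultimately show ?thesis using ppos by blast
qed

section \<open>Sequences with regular quotients\<close>

text \<open>The quantitative form of the two conditions on a quotient sequence: it grows at least
  like a positive power, and at most like a power. All properties required of the sequence
  constructed in the theorem, apart from the comparison with the given one, follow from
  these.\<close>

locale regular_quotients =
  fixes \<mu> :: "nat \<Rightarrow> real" and c \<delta> :: real and B :: nat
  assumes mono: "1 \<le> i \<Longrightarrow> i \<le> j \<Longrightarrow> \<mu> i \<le> \<mu> j"
    and first: "1 \<le> \<mu> 1"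
    and c: "0 < c" and \<delta>: "0 < \<delta>"
    and lower: "1 \<le> i \<Longrightarrow> i \<le> j \<Longrightarrow> c * (real j / real i) powr \<delta> * \<mu> i \<le> \<mu> j"
    and doubling: "1 \<le> j \<Longrightarrow> \<mu> (2 * j) \<le> 2 ^ B * \<mu> j"
begin

definition M :: "nat \<Rightarrow> real" where
  "M p = (\<Prod>k=1..p. \<mu> k)"

lemma ge_one: "1 \<le> \<mu> i" if "1 \<le> i"
  using mono[of 1 i] first that by linarith

lemma pos: "0 < \<mu> i" if "1 \<le> i"
  using ge_one[OF that] by linarith

lemma M_0 [simp]: "M 0 = 1"
  by (simp add: M_def)

lemma M_Suc: "M (Suc p) = M p * \<mu> (Suc p)"
  by (simp add: M_def)

lemma M_ge_one: "1 \<le> M p"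
  unfolding M_def by (intro prod_ge_1) (auto intro: ge_one)

lemma M_pos: "0 < M p"
  using M_ge_one[of p] by linarith

lemma quot_M: "1 \<le> k \<Longrightarrow> quot M k = \<mu> k"
  using M_pos[of "k - 1"] M_Suc[of "k - 1"] by (simp add: quot_def)

lemma ln_M: "ln (M p) = (\<Sum>k=1..p. ln (\<mu> k))"
  unfolding M_def using pos by (intro ln_prod) force+

text \<open>A weak form of \<open>M p \<ge> C ^ p * (fact p) powr \<delta>\<close>.\<close>

lemma ln_M_ge: "real p * (ln c - \<delta> + \<delta> * ln (real p)) \<le> ln (M p)"
proof -
  have "ln c + \<delta> * ln (real k) \<le> ln (\<mu> k)" if k: "k \<in> {1..p}" for k
  proof -
    have "c * real k powr \<delta> \<le> c * real k powr \<delta> * \<mu> 1"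
      using mult_left_mono[OF first, of "c * real k powr \<delta>"] c by simp
    also have "\<dots> \<le> \<mu> k" using lower[of 1 k] k by simp
    finally have "ln (c * real k powr \<delta>) \<le> ln (\<mu> k)"
      using c k by (intro ln_mono) auto
    then show ?thesis using c k by (simp add: ln_mult ln_powr)
  qed
  then have "(\<Sum>k=1..p. ln c + \<delta> * ln (real k)) \<le> ln (M p)"
    unfolding ln_M by (rule sum_mono)
  moreover have "\<delta> * (\<Sum>k=1..p. ln (real p) - ln (real k)) \<le> \<delta> * real p"
    using \<delta> sum_ln_gap_le[of p] by (intro mult_left_mono) auto
  ultimately show ?thesis
    by (simp add: sum.distrib sum_subtractf sum_distrib_left algebra_simps)
qed

lemma M_in_LC: "M \<in> LC"
proof -
  have "(M p)\<^sup>2 \<le> M (p - 1) * M (p + 1)" if p: "1 \<le> p" for p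
  proof -
    obtain n where n: "p = Suc n" using p by (cases p) auto
    have "(M p)\<^sup>2 = (M n * M p) * \<mu> p"
      unfolding n M_Suc by (simp add: power2_eq_square)
    also have "\<dots> \<le> (M n * M p) * \<mu> (Suc p)"
      using mono[of p "Suc p"] M_pos[of n] M_pos[of p] p by (intro mult_left_mono) auto
    finally show ?thesis by (simp add: n M_Suc mult_ac)
  qed
  moreover have "filterlim (\<lambda>p. M p powr (1 / real p)) at_top sequentially"
  proof (rule filterlim_at_top_mono)
    show "filterlim (\<lambda>p. exp (ln c - \<delta> + \<delta> * ln (real p))) at_top sequentially"
      using \<delta> by (intro filterlim_compose[OF exp_at_top] filterlim_tendsto_add_at_top[OF tendsto_const]
          filterlim_tendsto_pos_mult_at_top[OF tendsto_const]
          filterlim_compose[OF ln_at_top] filterlim_real_sequentially)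
    show "\<forall>\<^sub>F p in sequentially. exp (ln c - \<delta> + \<delta> * ln (real p)) \<le> M p powr (1 / real p)"
      using eventually_gt_at_top[of 0]
    proof eventually_elim
      case (elim p)
      then show ?case
        using ln_M_ge[of p] M_pos[of p] by (simp add: powr_def field_simps)
    qed
  qed
  ultimately show ?thesis
    using M_pos M_Suc[of 0] first by (simp add: LC_def)
qed

lemma upper: "1 \<le> i \<Longrightarrow> i \<le> j \<Longrightarrow> \<mu> j \<le> (2 * (real j / real i)) ^ B * \<mu> i"
  by (rule power_upper_bound) (use mono pos doubling in auto)

text \<open>Writing \<open>M (p + q) / M q\<close> as the product of the \<open>\<mu> (q + k)\<close>, \<open>k \<le> p\<close>, and comparing each
  factor with \<open>\<mu> k\<close>, the ratios \<open>(q + k) / k\<close> multiply up to the binomial coefficient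
  \<open>(p + q) choose p\<close>, which is at most \<open>2 ^ (p + q)\<close>.\<close>

lemma M_moderate_growth: "moderate_growth M"
proof -
  have bin: "M (p + q) \<le> (2 ^ p * real ((p + q) choose p)) ^ B * M p * M q" for p q
  proof (induction p)
    case (Suc p)
    define r where "r = real (p + q + 1) / real (p + 1)"
    have choose: "real ((Suc p + q) choose Suc p) = r * real ((p + q) choose p)"
      using arg_cong[OF Suc_times_binomial[of p "p + q"], of real]
      by (simp add: r_def field_simps del: binomial_Suc_Suc)
    have "M (Suc p + q) = M (p + q) * \<mu> (p + q + 1)"
      using M_Suc[of "p + q"] by simp
    also have "\<dots> \<le> ((2 ^ p * real ((p + q) choose p)) ^ B * M p * M q)
        * ((2 * r) ^ B * \<mu> (Suc p))"
      using upper[of "p + 1" "p + q + 1"] pos[of "p + q + 1"] M_pos[of p] M_pos[of q]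
      by (intro mult_mono Suc.IH) (auto simp: r_def)
    also have "\<dots> = (2 ^ p * real ((p + q) choose p) * (2 * r)) ^ B * M (Suc p) * M q"
      by (simp add: M_Suc power_mult_distrib mult_ac)
    also have "2 ^ p * real ((p + q) choose p) * (2 * r)
        = 2 ^ Suc p * real ((Suc p + q) choose Suc p)"
      unfolding choose by simp
    finally show ?case .
  qed simp
  have "M (p + q) \<le> (4 ^ B) ^ (p + q) * M p * M q" for p q
  proof -
    have "real ((p + q) choose p) \<le> 2 ^ (p + q)"
      using binomial_le_pow2[of "p + q" p] by (metis of_nat_le_iff of_nat_numeral of_nat_power)
    then have "2 ^ p * real ((p + q) choose p) \<le> 2 ^ (p + q) * 2 ^ (p + q)"
      by (intro mult_mono power_increasing) auto
    also have "\<dots> = (4::real) ^ (p + q)"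
      by (simp flip: power_mult_distrib)
    finally have "(2 ^ p * real ((p + q) choose p)) ^ B \<le> (4 ^ (p + q)) ^ B"
      by (intro power_mono) auto
    also have "\<dots> = (4 ^ B) ^ (p + q)" by (simp flip: power_mult add: mult.commute)
    finally show ?thesis
      using bin[of p q] M_pos[of p] M_pos[of q]
      by (meson less_imp_le mult_right_mono order.trans)
  qed
  then show ?thesis
    unfolding moderate_growth_def by (intro exI[of _ "4 ^ B"]) auto
qed

text \<open>The constant \<open>c\<close> of the power bound may be small, so the dilation \<open>Q\<close> has to be chosen
  anew, large enough that \<open>c * Q powr \<delta> \<ge> 2\<close>; the factor \<open>2\<close> is what \<open>omega_doubling\<close> needs.\<close>

lemma dilation_factor: obtains Q :: nat where "2 \<le> Q" "\<And>j. 1 \<le> j \<Longrightarrow> 2 * \<mu> j \<le> \<mu> (Q * j)"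
proof -
  define Q where "Q = max 2 (nat \<lceil>(2 / c) powr (1 / \<delta>)\<rceil>)"
  have Q: "2 \<le> Q" by (simp add: Q_def)
  have "(2 / c) powr (1 / \<delta>) \<le> real Q"
    unfolding Q_def using real_nat_ceiling_ge[of "(2 / c) powr (1 / \<delta>)"] by linarith
  then have "((2 / c) powr (1 / \<delta>)) powr \<delta> \<le> real Q powr \<delta>"
    using \<delta> by (intro powr_mono2) auto
  then have "2 \<le> c * real Q powr \<delta>"
    using c \<delta> by (simp add: powr_powr field_simps)
  moreover have "c * real Q powr \<delta> * \<mu> j \<le> \<mu> (Q * j)" if "1 \<le> j" for j
    using lower[of j "Q * j"] that Q by simp
  ultimately have "2 * \<mu> j \<le> \<mu> (Q * j)" if "1 \<le> j" for j
    using that pos[of j] by (meson less_imp_le mult_right_mono order.trans)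
  with Q show thesis by (rule that)
qed

lemma quot_dilation_limits:
  "\<exists>Q::nat. Q \<ge> 2 \<and>
     1 < liminf (\<lambda>j. ereal (quot M (Q * j) / quot M j)) \<and>
     liminf (\<lambda>j. ereal (quot M (Q * j) / quot M j))
       \<le> limsup (\<lambda>j. ereal (quot M (Q * j) / quot M j)) \<and>
     limsup (\<lambda>j. ereal (quot M (Q * j) / quot M j)) < \<infinity>"
proof -
  obtain Q :: nat where Q: "2 \<le> Q" and big: "\<And>j. 1 \<le> j \<Longrightarrow> 2 * \<mu> j \<le> \<mu> (Q * j)"
    using dilation_factor by blast
  let ?r = "\<lambda>j. ereal (quot M (Q * j) / quot M j)"
  have "\<forall>\<^sub>F j in sequentially. 2 \<le> ?r j \<and> ?r j \<le> ereal ((2 * real Q) ^ B)"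
    using eventually_ge_at_top[of 1]
  proof eventually_elim
    case (elim j)
    then show ?case
      using big[of j] upper[of j "Q * j"] pos[of j] Q
      by (simp add: quot_M field_simps)
  qed
  then have lo: "\<forall>\<^sub>F j in sequentially. 2 \<le> ?r j"
    and hi: "\<forall>\<^sub>F j in sequentially. ?r j \<le> ereal ((2 * real Q) ^ B)"
    by (auto elim: eventually_mono)
  have "2 \<le> liminf ?r" using lo by (rule Liminf_bounded)
  then have "1 < liminf ?r" by (rule less_le_trans[rotated]) simp
  moreover have "limsup ?r < \<infinity>"
    using Limsup_bounded[OF hi] by (rule le_less_trans) simp
  ultimately show ?thesis
    using Q Liminf_le_Limsup[of sequentially ?r] by auto
qed

section \<open>The associated function as a weight function\<close>

text \<open>A real-valued version of the associated function. At \<open>t = 0\<close> the value \<open>ln 0 = 0\<close> makes the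
  supremum equal to \<open>0\<close>, which is the correct value: there the term \<open>p = 0\<close> contributes
  \<open>log 1\<close> and all others contribute \<open>-\<infinity>\<close>.\<close>

definition omega :: "real \<Rightarrow> real" where
  "omega t = (SUP p. real p * ln t - ln (M p))"

lemma omega_bdd: "bdd_above (range (\<lambda>p. real p * ln t - ln (M p)))"
proof (rule bdd_aboveI2)
  fix p :: nat
  define A where "A = ln t - ln c + \<delta>"
  have "real p * ln t - ln (M p) \<le> real p * (A - \<delta> * ln (real p))"
    using ln_M_ge[of p] by (simp add: A_def algebra_simps)
  also have "\<dots> \<le> exp (A / \<delta>) * \<bar>A\<bar>"
  proof (cases "p = 0 \<or> A / \<delta> \<le> ln (real p)")
    case True
    then have "real p * (A - \<delta> * ln (real p)) \<le> 0"
      using \<delta> by (cases "p = 0") (auto simp: pos_divide_le_eq mult.commute[of _ \<delta>] intro!: mult_nonneg_nonpos)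
    also have "\<dots> \<le> exp (A / \<delta>) * \<bar>A\<bar>" by simp
    finally show ?thesis .
  next
    case False
    then have "real p \<le> exp (A / \<delta>)"
      by (metis exp_ln exp_le_cancel_iff linorder_le_cases of_nat_0_less_iff neq0_conv)
    moreover have "0 \<le> \<delta> * ln (real p)" using \<delta> False by simp
    then have "A - \<delta> * ln (real p) \<le> \<bar>A\<bar>" by linarith
    moreover have "0 \<le> A - \<delta> * ln (real p)" using False \<delta> by (simp add: field_simps)
    ultimately show ?thesis by (intro mult_mono) auto
  qed
  finally show "real p * ln t - ln (M p) \<le> exp (ln t / \<delta> - ln c / \<delta> + 1) * \<bar>ln t - ln c + \<delta>\<bar>"
    using \<delta> by (simp add: A_def add_divide_distrib diff_divide_distrib)
qed

lemma omega_ge: "real p * ln t - ln (M p) \<le> omega t"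
  unfolding omega_def by (intro cSUP_upper omega_bdd) simp

lemma omega_le: "(\<And>p. real p * ln t - ln (M p) \<le> u) \<Longrightarrow> omega t \<le> u"
  unfolding omega_def by (intro cSUP_least) auto

lemma omega_nonneg: "0 \<le> omega t"
  using omega_ge[of 0 t] by simp

lemma omega_eq_0: "omega t = 0" if "0 \<le> t" "t \<le> 1"
proof (rule antisym[OF omega_le omega_nonneg])
  fix p
  have "ln t \<le> 0" using that by (cases "t = 0") auto
  moreover have "0 \<le> ln (M p)" using M_ge_one[of p] by simp
  ultimately show "real p * ln t - ln (M p) \<le> 0"
    by (smt (verit) mult_nonneg_nonpos of_nat_0_le_iff)
qed

lemma omega_mono: "omega s \<le> omega t" if "0 \<le> s" "s \<le> t"
proof (cases "s = 0")
  case True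
  then show ?thesis using omega_eq_0[of 0] omega_nonneg[of t] by simp
next
  case False
  show ?thesis
  proof (rule omega_le)
    fix p
    have "real p * ln s \<le> real p * ln t"
      using that False by (intro mult_left_mono) auto
    then show "real p * ln s - ln (M p) \<le> omega t"
      using omega_ge[of p t] by linarith
  qed
qed

lemma assoc_fun_eq_omega: "assoc_fun M t = ereal (omega t)" if "0 \<le> t"
proof -
  have elog: "elog (\<bar>t\<bar> ^ p / M p) = ereal (real p * ln t - ln (M p))" if "t \<noteq> 0 \<or> p = 0" for p
    using that \<open>0 \<le> t\<close> M_pos[of p] by (auto simp: elog_def ln_div ln_realpow)
  show ?thesis
    unfolding assoc_fun_def
  proof (rule SUP_eqI)
    fix p
    show "elog (\<bar>t\<bar> ^ p / M p) \<le> ereal (omega t)"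
    proof (cases "t = 0 \<and> p \<noteq> 0")
      case True
      then show ?thesis by (simp add: elog_def)
    next
      case False
      then show ?thesis using elog[of p] omega_ge[of p t] by simp
    qed
  next
    fix y assume y: "\<And>p. p \<in> UNIV \<Longrightarrow> elog (\<bar>t\<bar> ^ p / M p) \<le> y"
    show "ereal (omega t) \<le> y"
    proof (cases "t = 0")
      case True
      then show ?thesis using y[of 0] elog[of 0] omega_eq_0[of 0] by simp
    next
      case False
      show ?thesis
      proof (cases y)
        case (real r)
        have "omega t \<le> r" using y elog False real by (intro omega_le) auto
        then show ?thesis using real by simp
      qed (use y[of 0] elog[of 0] in auto)
    qed
  qed
qed

text \<open>In the variable \<open>x = ln t\<close> the associated function is a supremum of affine functions.\<close>

lemma omega_exp_convex: "convex_on UNIV (\<lambda>x. omega (exp x))"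
proof (rule convex_onI)
  fix u x y :: real assume u: "0 < u" "u < 1"
  show "omega (exp ((1 - u) *\<^sub>R x + u *\<^sub>R y)) \<le> (1 - u) * omega (exp x) + u * omega (exp y)"
  proof (rule omega_le)
    fix p
    have "(1 - u) * (real p * x - ln (M p)) \<le> (1 - u) * omega (exp x)"
      using u omega_ge[of p "exp x"] by (intro mult_left_mono) auto
    moreover have "u * (real p * y - ln (M p)) \<le> u * omega (exp y)"
      using u omega_ge[of p "exp y"] by (intro mult_left_mono) auto
    ultimately show "real p * ln (exp ((1 - u) *\<^sub>R x + u *\<^sub>R y)) - ln (M p)
        \<le> (1 - u) * omega (exp x) + u * omega (exp y)"
      by (simp add: algebra_simps)
  qed
qed simp

text \<open>Convexity on the whole line gives continuity of \<open>omega \<circ> exp\<close>, hence of \<open>omega\<close> away from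
  \<open>0\<close>; near \<open>0\<close> the function vanishes identically.\<close>

lemma omega_continuous: "continuous_on {0..} omega"
proof -
  have "continuous_on {1..} (\<lambda>t. omega (exp (ln t)))"
    using convex_on_continuous[OF open_UNIV omega_exp_convex]
    by (rule continuous_on_compose2) (auto intro!: continuous_intros)
  then have "continuous_on {1..} omega"
    by (rule continuous_on_eq) auto
  moreover have "continuous_on {0..1} omega"
    by (rule continuous_on_eq[of _ "\<lambda>_. 0"]) (auto simp: omega_eq_0)
  ultimately have "continuous_on ({0..1} \<union> {1..}) omega"
    by (intro continuous_on_closed_Un) auto
  moreover have "{0..1} \<union> {1..} = {0::real..}" by auto
  ultimately show ?thesis by simp
qed

lemma ln_smallo_omega: "ln \<in> o[at_top](omega)"
proof (rule landau_o.smallI)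
  fix e :: real assume e: "0 < e"
  obtain p :: nat where p: "2 / e \<le> real p" using real_arch_simple by blast
  have "\<forall>\<^sub>F t in at_top. max 0 (e * ln (M p)) \<le> ln t"
    using ln_at_top unfolding filterlim_at_top by blast
  then show "\<forall>\<^sub>F t in at_top. norm (ln t) \<le> e * norm (omega t)"
  proof eventually_elim
    case (elim t)
    have "2 \<le> e * real p" using p e by (simp add: field_simps)
    then have "2 * ln t \<le> (e * real p) * ln t"
      using elim by (intro mult_right_mono) auto
    moreover have "e * (real p * ln t - ln (M p)) \<le> e * omega t"
      using e omega_ge by (intro mult_left_mono) auto
    ultimately have "ln t \<le> e * omega t"
      using elim by (simp add: algebra_simps)
    then show ?case using elim omega_nonneg[of t] by simp
  qed
qed

text \<open>The supremum defining \<open>omega t\<close> is attained at the last \<open>p\<close> with \<open>\<mu> p \<le> t\<close>, and equals the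
  sum of the positive parts of all \<open>ln (t / \<mu> k)\<close>.\<close>

lemma sum_ln_plus_le_omega:
  assumes "0 < t"
  shows "(\<Sum>k=1..n. max 0 (ln t - ln (\<mu> k))) \<le> omega t"
proof (induction n)
  case 0
  show ?case by (simp add: omega_nonneg)
next
  case (Suc n)
  show ?case
  proof (cases "t \<le> \<mu> (Suc n)")
    case True
    then have "ln t \<le> ln (\<mu> (Suc n))" using assms by simp
    then show ?thesis using Suc.IH by simp
  next
    case False
    have "max 0 (ln t - ln (\<mu> k)) = ln t - ln (\<mu> k)" if "k \<in> {1..Suc n}" for k
      using False mono[of k "Suc n"] pos[of k] that by simp
    then have "(\<Sum>k=1..Suc n. max 0 (ln t - ln (\<mu> k))) = real (Suc n) * ln t - ln (M (Suc n))"
      unfolding ln_M by (simp add: sum_subtractf)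
    then show ?thesis using omega_ge[of "Suc n" t] by simp
  qed
qed

text \<open>Since \<open>\<mu> k \<ge> \<mu> (Q * m) \<ge> 2 * \<mu> m\<close> for \<open>m = k div Q \<ge> 1\<close>, each term \<open>ln (2 * t / \<mu> k)\<close> is
  dominated by the positive part of \<open>ln (t / \<mu> m)\<close>. Every \<open>m\<close> serves at most \<open>Q\<close> indices
  \<open>k\<close>, so summation costs the factor \<open>Q\<close>. The block \<open>k < Q\<close> has no such partner and is
  compared with \<open>\<mu> 1\<close> instead, which costs the additional \<open>ln 2\<close> in \<open>F 0\<close>.\<close>

lemma omega_doubling: "\<exists>L\<ge>1. \<forall>t\<ge>0. omega (2 * t) \<le> L * (omega t + 1)"
proof -
  obtain Q :: nat where Q: "2 \<le> Q" and big: "\<And>j. 1 \<le> j \<Longrightarrow> 2 * \<mu> j \<le> \<mu> (Q * j)"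
    using dilation_factor by blast
  have "omega (2 * t) \<le> 2 * real Q * (omega t + 1)" if t: "0 \<le> t" for t
  proof (cases "t = 0")
    case True
    then show ?thesis using omega_eq_0[of 0] by simp
  next
    case False
    define f where "f m = max 0 (ln t - ln (\<mu> m))" for m
    \<comment> \<open>an upper bound for every term of the block \<open>k div Q = m\<close>\<close>
    define F where "F m = (if m = 0 then ln 2 + f 1 else f m)" for m :: nat
    have ln2t: "ln (2 * t) = ln 2 + ln t" using t False by (simp add: ln_mult)
    have term_le: "ln (2 * t) - ln (\<mu> k) \<le> F (k div Q)" if k: "1 \<le> k" for k
    proof (cases "k div Q = 0")
      case True
      have "ln (\<mu> 1) \<le> ln (\<mu> k)" using first mono[of 1 k] k by simp
      then show ?thesis unfolding F_def f_def ln2t using True by simp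
    next
      case False
      define m where "m = k div Q"
      have m: "1 \<le> m" "Q * m \<le> k" using False by (auto simp: m_def Suc_le_eq)
      have "2 * \<mu> m \<le> \<mu> (Q * m)" using m(1) by (rule big)
      also have "\<dots> \<le> \<mu> k" using m Q by (intro mono) (auto simp: Suc_le_eq)
      finally have "ln (2 * \<mu> m) \<le> ln (\<mu> k)" using pos[OF m(1)] by simp
      then show ?thesis
        using False pos[OF m(1)] unfolding F_def f_def ln2t m_def[symmetric] by (simp add: ln_mult)
    qed
    have F_nonneg: "0 \<le> F m" for m by (simp add: F_def f_def add_nonneg_nonneg)
    have "F 0 \<le> 1 + omega t"
      using sum_ln_plus_le_omega[of t 1] t False ln_le_minus_one[of 2] by (simp add: F_def f_def max_def)
    moreover have "(\<Sum>m=1..n. F m) \<le> omega t" for n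
      using sum_ln_plus_le_omega[of t n] t False by (simp add: F_def f_def)
    ultimately have F_sum: "(\<Sum>m<Suc n. F m) \<le> 1 + 2 * omega t" for n
      unfolding sum.lessThan_Suc_shift using omega_nonneg[of t]
      by (simp add: sum.atLeast1_atMost_eq) (smt (verit))
    show ?thesis
    proof (rule omega_le)
      fix p
      have "real p * ln (2 * t) - ln (M p) = (\<Sum>k=1..p. ln (2 * t) - ln (\<mu> k))"
        unfolding ln_M by (simp add: sum_subtractf)
      also have "\<dots> \<le> (\<Sum>k=1..p. F (k div Q))"
        by (intro sum_mono term_le) auto
      also have "\<dots> \<le> (\<Sum>k<Suc p * Q. F (k div Q))"
      proof (intro sum_mono2 F_nonneg)
        have "p < Suc p * Q" using Q by (cases Q) auto
        then show "{1..p} \<subseteq> {..<Suc p * Q}" by auto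
      qed auto
      also have "\<dots> = (\<Sum>m<Suc p. \<Sum>k=m * Q..<m * Q + Q. F (k div Q))"
        by (rule sum.nat_group[symmetric])
      also have "\<dots> = (\<Sum>m<Suc p. \<Sum>k=m * Q..<m * Q + Q. F m)"
      proof (intro sum.cong refl)
        fix m k assume "k \<in> {m * Q..<m * Q + Q}"
        then have "k div Q = m" by (intro div_nat_eqI) (auto simp: mult.commute)
        then show "F (k div Q) = F m" by simp
      qed
      also have "\<dots> = real Q * (\<Sum>m<Suc p. F m)"
        by (simp add: sum_distrib_left del: sum.lessThan_Suc)
      also have "\<dots> \<le> real Q * (1 + 2 * omega t)"
        by (intro mult_left_mono F_sum) auto
      also have "\<dots> \<le> 2 * real Q * (omega t + 1)" by (simp add: algebra_simps)
      finally show "real p * ln (2 * t) - ln (M p) \<le> 2 * real Q * (omega t + 1)" .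
    qed
  qed
  then show ?thesis using Q by (intro exI[of _ "2 * real Q"]) auto
qed

lemma omega_general_weight_function: "general_weight_function omega"
  unfolding general_weight_function_def
  using omega_nonneg omega_continuous omega_mono omega_doubling ln_smallo_omega
    convex_on_subset[OF omega_exp_convex subset_UNIV]
  by (auto simp: mono_on_def)

end

section \<open>An oscillating perturbation of the quotients\<close>

text \<open>Multiplying \<open>\<nu> k\<close> by \<open>exp (\<epsilon> / 4 * osc (ln k))\<close> changes ratios \<open>\<nu> j / \<nu> i\<close> by a factor of at
  most \<open>(j / i) powr (\<epsilon> / 2)\<close>, as \<open>osc\<close> has Lipschitz constant \<open>2\<close>; half of the power growth is
  left over. The product \<open>a\<close> need not be monotone, but it is so up to the constant \<open>c\<close>, and its
  running maximum \<open>\<mu>\<close> therefore stays comparable to it.\<close>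

lemma oscillating_perturbation:
  fixes \<nu> :: "nat \<Rightarrow> real"
  assumes mono: "\<And>i j. 1 \<le> i \<Longrightarrow> i \<le> j \<Longrightarrow> \<nu> i \<le> \<nu> j"
    and first: "1 \<le> \<nu> 1"
    and \<epsilon>: "0 < \<epsilon>" and c: "0 < c"
    and lower: "\<And>i j. 1 \<le> i \<Longrightarrow> i \<le> j \<Longrightarrow> c * (real j / real i) powr \<epsilon> * \<nu> i \<le> \<nu> j"
    and doubling: "\<And>j. 1 \<le> j \<Longrightarrow> \<nu> (2 * j) \<le> D * \<nu> j"
  obtains \<mu> B where "regular_quotients \<mu> (c\<^sup>2) (\<epsilon> / 2) B"
    "\<And>k. 1 \<le> k \<Longrightarrow> \<bar>ln (\<mu> k) - ln (\<nu> k) - \<epsilon> / 4 * osc (ln (real k))\<bar> \<le> \<bar>ln c\<bar>"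
proof -
  define h where "h k = \<epsilon> / 4 * osc (ln (real k))" for k
  define a where "a k = \<nu> k * exp (h k)" for k
  define \<mu> where "\<mu> k = Max (a ` {1..k})" for k
  have \<nu>_pos: "0 < \<nu> i" if "1 \<le> i" for i using mono[of 1 i] first that by linarith
  have a_pos: "0 < a i" if "1 \<le> i" for i using \<nu>_pos[OF that] by (simp add: a_def)
  have h_lip: "\<bar>h j - h i\<bar> \<le> \<epsilon> / 2 * ln (real j / real i)" if ij: "1 \<le> i" "i \<le> j" for i j
  proof -
    have "\<bar>osc (ln (real j)) - osc (ln (real i))\<bar> \<le> 2 * \<bar>ln (real j) - ln (real i)\<bar>"
      using ij by (intro osc_lipschitz) auto
    also have "\<bar>ln (real j) - ln (real i)\<bar> = ln (real j / real i)"
      using ij by (simp add: ln_div)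
    finally have "\<epsilon> / 4 * \<bar>osc (ln (real j)) - osc (ln (real i))\<bar>
        \<le> \<epsilon> / 4 * (2 * ln (real j / real i))"
      using \<epsilon> by (intro mult_left_mono) auto
    also have "\<epsilon> / 4 * \<bar>osc (ln (real j)) - osc (ln (real i))\<bar> = \<bar>h j - h i\<bar>"
      unfolding h_def right_diff_distrib[symmetric] abs_mult using \<epsilon> by simp
    finally show ?thesis by simp
  qed
  have a_lower: "c * (real j / real i) powr (\<epsilon> / 2) * a i \<le> a j" if ij: "1 \<le> i" "i \<le> j" for i j
  proof -
    let ?r = "real j / real i"
    have "exp (h i) \<le> exp (\<epsilon> / 2 * ln ?r + h j)"
      using h_lip[OF ij] unfolding exp_le_cancel_iff by linarith
    also have "\<dots> = ?r powr (\<epsilon> / 2) * exp (h j)"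
      using ij by (simp add: powr_def exp_add)
    finally have "c * ?r powr (\<epsilon> / 2) * \<nu> i * exp (h i)
        \<le> c * ?r powr (\<epsilon> / 2) * \<nu> i * (?r powr (\<epsilon> / 2) * exp (h j))"
      using c \<nu>_pos[OF ij(1)] by (intro mult_left_mono) auto
    also have "\<dots> = c * (?r powr (\<epsilon> / 2) * ?r powr (\<epsilon> / 2)) * \<nu> i * exp (h j)"
      by (simp add: mult_ac)
    also have "?r powr (\<epsilon> / 2) * ?r powr (\<epsilon> / 2) = ?r powr \<epsilon>"
      by (simp flip: powr_add)
    also have "c * ?r powr \<epsilon> * \<nu> i * exp (h j) \<le> \<nu> j * exp (h j)"
      by (intro mult_right_mono lower ij) auto
    finally show ?thesis by (simp add: a_def mult_ac)
  qed
  have a_le: "a k \<le> \<mu> k" if "1 \<le> k" for k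
    unfolding \<mu>_def using that by (intro Max_ge) auto
  have le_a: "c * \<mu> k \<le> a k" if k: "1 \<le> k" for k
  proof -
    have "\<mu> k \<in> a ` {1..k}" unfolding \<mu>_def using k by (intro Max_in) auto
    then obtain i where i: "1 \<le> i" "i \<le> k" "\<mu> k = a i" by auto
    have "c * 1 * a i \<le> c * (real k / real i) powr (\<epsilon> / 2) * a i"
      using c a_pos[OF i(1)] i \<epsilon>
      by (intro mult_right_mono mult_left_mono ge_one_powr_ge_zero) auto
    also have "\<dots> \<le> a k" by (rule a_lower[OF i(1,2)])
    finally show ?thesis using i(3) by simp
  qed
  have \<mu>_pos: "0 < \<mu> k" if "1 \<le> k" for k
    using a_pos[OF that] a_le[OF that] by linarith
  \<comment> \<open>the doubling constant of \<open>\<mu>\<close>: that of \<open>\<nu>\<close>, the oscillation over one octave, and the loss \<open>1 / c\<close> of the running maximum\<close>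
  define E where "E = D * exp (\<epsilon> / 2 * ln 2) / c"
  have cE: "c * E = D * exp (\<epsilon> / 2 * ln 2)" using c by (simp add: E_def)
  obtain B where B: "E < 2 ^ B" using real_arch_pow[of 2 E] by auto
  have "regular_quotients \<mu> (c\<^sup>2) (\<epsilon> / 2) B"
  proof
    show "\<mu> i \<le> \<mu> j" if "1 \<le> i" "i \<le> j" for i j
      unfolding \<mu>_def using that by (intro Max_mono) auto
    show "1 \<le> \<mu> 1" using first by (simp add: \<mu>_def a_def h_def osc_def)
    show "0 < c\<^sup>2" "0 < \<epsilon> / 2" using c \<epsilon> by auto
    show "c\<^sup>2 * (real j / real i) powr (\<epsilon> / 2) * \<mu> i \<le> \<mu> j" if ij: "1 \<le> i" "i \<le> j" for i j
    proof -
      have "c * (real j / real i) powr (\<epsilon> / 2) * (c * \<mu> i)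
          \<le> c * (real j / real i) powr (\<epsilon> / 2) * a i"
        using c by (intro mult_left_mono le_a ij) auto
      also have "\<dots> \<le> a j" by (rule a_lower[OF ij])
      also have "\<dots> \<le> \<mu> j" using ij by (intro a_le) auto
      finally show ?thesis by (simp add: power2_eq_square mult_ac)
    qed
    show "\<mu> (2 * j) \<le> 2 ^ B * \<mu> j" if j: "1 \<le> j" for j
    proof -
      have "h (2 * j) \<le> \<epsilon> / 2 * ln 2 + h j" using abs_le_D1[OF h_lip[of j "2 * j"]] j by simp
      then have "exp (h (2 * j)) \<le> exp (\<epsilon> / 2 * ln 2) * exp (h j)" by (simp flip: exp_add)
      then have "a (2 * j) \<le> (D * \<nu> j) * (exp (\<epsilon> / 2 * ln 2) * exp (h j))"
        unfolding a_def using \<nu>_pos[of "2 * j"] doubling[OF j] j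
        by (intro mult_mono) auto
      also have "\<dots> = c * E * a j" unfolding cE a_def by (simp only: mult_ac)
      finally have "c * \<mu> (2 * j) \<le> c * (E * a j)"
        using le_a[of "2 * j"] j by (simp add: mult.assoc)
      then have "\<mu> (2 * j) \<le> E * a j" using c by simp
      also have "\<dots> \<le> 2 ^ B * \<mu> j"
        using B a_pos[OF j] a_le[OF j] by (intro mult_mono) auto
      finally show ?thesis .
    qed
  qed
  moreover have "\<bar>ln (\<mu> k) - ln (\<nu> k) - \<epsilon> / 4 * osc (ln (real k))\<bar> \<le> \<bar>ln c\<bar>" if k: "1 \<le> k" for k
  proof -
    have "ln (a k) = ln (\<nu> k) + h k" using \<nu>_pos[OF k] by (simp add: a_def ln_mult)
    moreover have "ln (a k) \<le> ln (\<mu> k)" using a_pos[OF k] a_le[OF k] by simp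
    moreover have "ln (c * \<mu> k) \<le> ln (a k)"
      using c \<mu>_pos[OF k] le_a[OF k] by (intro ln_mono) auto
    ultimately show ?thesis using c \<mu>_pos[OF k] by (simp add: ln_mult h_def)
  qed
  ultimately show thesis by (rule that)
qed

section \<open>Comparison of the two sequences\<close>

text \<open>Passing from quotients to roots of the sequences replaces a function of \<open>k\<close> by its mean over
  \<open>k \<le> p\<close>; on the logarithmic scale this mean follows the value at \<open>p\<close>.\<close>

lemma average_osc_ln:
  assumes dev: "\<And>k. 1 \<le> k \<Longrightarrow> \<bar>d k - s * osc (ln (real k))\<bar> \<le> K" and s: "0 \<le> s"
  shows "\<bar>(\<Sum>k=1..p. d k) - real p * (s * osc (ln (real p)))\<bar> \<le> real p * (K + 2 * s)"
proof -
  have "\<bar>d k - s * osc (ln (real p))\<bar> \<le> K + s * (2 * (ln (real p) - ln (real k)))"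
    if k: "k \<in> {1..p}" for k
  proof -
    have "\<bar>osc (ln (real k)) - osc (ln (real p))\<bar> \<le> 2 * (ln (real p) - ln (real k))"
      using osc_lipschitz[of "ln (real k)" "ln (real p)"] k by simp
    then have "s * \<bar>osc (ln (real k)) - osc (ln (real p))\<bar> \<le> s * (2 * (ln (real p) - ln (real k)))"
      using s by (rule mult_left_mono)
    moreover have "s * \<bar>osc (ln (real k)) - osc (ln (real p))\<bar>
        = \<bar>s * osc (ln (real k)) - s * osc (ln (real p))\<bar>"
      unfolding right_diff_distrib[symmetric] abs_mult using s by simp
    moreover have "\<bar>d k - s * osc (ln (real k))\<bar> \<le> K" using dev[of k] k by simp
    ultimately show ?thesis by linarith
  qed
  then have "(\<Sum>k=1..p. \<bar>d k - s * osc (ln (real p))\<bar>)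
      \<le> (\<Sum>k=1..p. K + s * (2 * (ln (real p) - ln (real k))))"
    by (rule sum_mono)
  also have "\<dots> = real p * K + 2 * s * (\<Sum>k=1..p. ln (real p) - ln (real k))"
    by (simp only: sum.distrib sum_distrib_left) (simp add: mult_ac)
  also have "\<dots> \<le> real p * K + 2 * s * real p"
    using s by (intro add_left_mono mult_left_mono sum_ln_gap_le) auto
  finally have "(\<Sum>k=1..p. \<bar>d k - s * osc (ln (real p))\<bar>) \<le> real p * (K + 2 * s)"
    by (simp add: algebra_simps)
  then show ?thesis
    using sum_abs[of "\<lambda>k. d k - s * osc (ln (real p))" "{1..p}"] by (simp add: sum_subtractf)
qed

lemma power_powr_inverse: "0 < C \<Longrightarrow> 0 < p \<Longrightarrow> (C ^ p) powr (1 / real p) = C" for C :: real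
  by (simp add: powr_realpow[symmetric] powr_powr)

lemma limsup_root_finite_if_preceq:
  assumes M: "\<And>p. 0 < M p" and N: "\<And>p. 0 < N p" and le: "M \<preceq> N"
  shows "limsup (\<lambda>p. ereal ((M p / N p) powr (1 / real p))) < \<infinity>"
proof -
  obtain C where C: "1 \<le> C" and MN: "\<And>p. M p \<le> C ^ p * N p"
    using le by (auto simp: preceq_def)
  have "\<forall>\<^sub>F p in sequentially. ereal ((M p / N p) powr (1 / real p)) \<le> ereal C"
    using eventually_gt_at_top[of 0]
  proof eventually_elim
    case (elim p)
    have "(M p / N p) powr (1 / real p) \<le> (C ^ p) powr (1 / real p)"
      using M[of p] N[of p] MN[of p] by (intro powr_mono2) (simp_all add: pos_divide_le_eq less_imp_le)
    also have "\<dots> = C" using C elim by (simp add: power_powr_inverse)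
    finally show ?case by simp
  qed
  from Limsup_bounded[OF this] show ?thesis by (rule le_less_trans) simp
qed

lemma liminf_root_pos_if_preceq:
  assumes M: "\<And>p. 0 < M p" and N: "\<And>p. 0 < N p" and le: "N \<preceq> M"
  shows "0 < liminf (\<lambda>p. ereal ((M p / N p) powr (1 / real p)))"
proof -
  obtain C where C: "1 \<le> C" and NM: "\<And>p. N p \<le> C ^ p * M p"
    using le by (auto simp: preceq_def)
  have "\<forall>\<^sub>F p in sequentially. ereal (1 / C) \<le> ereal ((M p / N p) powr (1 / real p))"
    using eventually_gt_at_top[of 0]
  proof eventually_elim
    case (elim p)
    have "(1 / C) ^ p * N p \<le> M p"
      using NM[of p] C by (simp add: power_one_over pos_divide_le_eq mult.commute)
    then have "((1 / C) ^ p) powr (1 / real p) \<le> (M p / N p) powr (1 / real p)"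
      using C N[of p] by (intro powr_mono2) (simp_all add: pos_le_divide_eq)
    moreover have "((1 / C) ^ p) powr (1 / real p) = 1 / C"
      using C elim by (intro power_powr_inverse) auto
    ultimately show ?case by simp
  qed
  from Liminf_bounded[OF this] show ?thesis
    by (rule less_le_trans[rotated]) (use C in simp)
qed

lemma root_limits_of_oscillation:
  fixes M N :: "nat \<Rightarrow> real"
  assumes M: "\<And>p. 0 < M p" and N: "\<And>p. 0 < N p" and s: "0 < s"
    and dev: "\<And>p. \<bar>ln (M p) - ln (N p) - real p * (s * osc (ln (real p)))\<bar> \<le> real p * K"
  shows "liminf (\<lambda>p. ereal ((M p / N p) powr (1 / real p))) = 0"
    and "limsup (\<lambda>p. ereal ((M p / N p) powr (1 / real p))) = \<infinity>"
proof -
  define r where "r p = (M p / N p) powr (1 / real p)" for p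
  have bounds: "exp (s * osc (ln (real p)) - K) \<le> r p" "r p \<le> exp (s * osc (ln (real p)) + K)"
    if "1 \<le> p" for p
  proof -
    have "r p = exp ((ln (M p) - ln (N p)) / real p)"
      using M[of p] N[of p] by (simp add: r_def powr_def ln_div)
    moreover have "(ln (M p) - ln (N p)) / real p - s * osc (ln (real p))
        = (ln (M p) - ln (N p) - real p * (s * osc (ln (real p)))) / real p"
      using that by (simp add: diff_divide_distrib)
    then have "\<bar>(ln (M p) - ln (N p)) / real p - s * osc (ln (real p))\<bar> \<le> K"
      using dev[of p] that by (simp add: pos_divide_le_eq mult.commute[of K])
    ultimately show "exp (s * osc (ln (real p)) - K) \<le> r p"
      "r p \<le> exp (s * osc (ln (real p)) + K)" by (simp_all add: abs_le_iff)
  qed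
  have "\<not> 0 < liminf (\<lambda>p. ereal (r p))"
  proof
    assume "0 < liminf (\<lambda>p. ereal (r p))"
    then obtain z where z: "0 < ereal z" "ereal z < liminf (\<lambda>p. ereal (r p))"
      using ereal_dense2 by blast
    from less_LiminfD[OF z(2)] obtain n where n: "\<And>p. n \<le> p \<Longrightarrow> z < r p"
      by (auto simp: eventually_sequentially)
    obtain p where p: "n \<le> p" "1 \<le> p" "(K - ln z) / s \<le> - 1 * osc (ln (real p))"
      using osc_ln_unbounded[of "-1" n "(K - ln z) / s"] by auto
    have "s * osc (ln (real p)) + K \<le> ln z" using p(3) s by (simp add: field_simps)
    then have "exp (s * osc (ln (real p)) + K) \<le> z" using z(1) by (simp add: ln_ge_iff)
    with bounds(2)[OF p(2)] n[OF p(1)] show False by linarith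
  qed
  moreover have "0 \<le> liminf (\<lambda>p. ereal (r p))"
    by (rule Liminf_bounded) (simp add: r_def)
  ultimately show "liminf (\<lambda>p. ereal ((M p / N p) powr (1 / real p))) = 0"
    unfolding r_def[symmetric] by (simp add: not_less antisym)
  have "\<not> limsup (\<lambda>p. ereal (r p)) < \<infinity>"
  proof
    assume "limsup (\<lambda>p. ereal (r p)) < \<infinity>"
    then obtain z where z: "limsup (\<lambda>p. ereal (r p)) < ereal z"
      using ereal_dense2 by blast
    from Limsup_lessD[OF z] obtain n where n: "\<And>p. n \<le> p \<Longrightarrow> r p < z"
      by (auto simp: eventually_sequentially)
    obtain p where p: "n \<le> p" "1 \<le> p" "(K + z) / s \<le> 1 * osc (ln (real p))"
      using osc_ln_unbounded[of 1 n "(K + z) / s"] by auto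
    have "z \<le> s * osc (ln (real p)) - K" using p(3) s by (simp add: field_simps)
    also have "\<dots> \<le> exp (s * osc (ln (real p)) - K)"
      using exp_ge_add_one_self[of "s * osc (ln (real p)) - K"] by linarith
    finally show False using bounds(1)[OF p(2)] n[OF p(1)] by linarith
  qed
  then show "limsup (\<lambda>p. ereal ((M p / N p) powr (1 / real p))) = \<infinity>"
    unfolding r_def[symmetric] by simp
qed

section \<open>Log-convex sequences and the theorem\<close>

lemma LC_pos: "N \<in> LC \<Longrightarrow> 0 < N p"
  by (simp add: LC_def)

lemma LC_quot_ge_one:
  assumes "N \<in> LC"
  shows "1 \<le> quot N 1"
  using assms by (simp add: LC_def quot_def)

lemma LC_quot_mono:
  assumes N: "N \<in> LC" and ij: "1 \<le> i" "i \<le> j"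
  shows "quot N i \<le> quot N j"
  using ij(2,1)
proof (induction rule: dec_induct)
  case (step j)
  have "1 \<le> j" using step by linarith
  then have "(N j)\<^sup>2 \<le> N (j - 1) * N (Suc j)" using N by (simp add: LC_def)
  then have "quot N j \<le> quot N (Suc j)"
    using LC_pos[OF N] by (simp add: quot_def field_simps power2_eq_square)
  with step show ?case by simp
qed simp

lemma LC_ln_eq_sum:
  assumes "N \<in> LC"
  shows "ln (N p) = (\<Sum>k=1..p. ln (quot N k))"
proof (induction p)
  case 0
  show ?case using assms by (simp add: LC_def)
next
  case (Suc p)
  have "ln (quot N (Suc p)) = ln (N (Suc p)) - ln (N p)"
    using LC_pos[OF assms, of p] LC_pos[OF assms, of "Suc p"] by (simp add: quot_def ln_div)
  with Suc show ?case by simp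
qed

theorem mainTheorem1:
  fixes N :: "nat \<Rightarrow> real"
  assumes "N \<in> LC"
    and "\<exists>Q::nat. Q \<ge> 1 \<and>
           1 < liminf (\<lambda>j. ereal (quot N (Q * j) / quot N j)) \<and>
           (SUP j\<in>{1..}. ereal (quot N (2 * j) / quot N j)) < \<infinity>"
  shows "\<exists>M\<in>LC.
           (\<exists>\<omega>. (\<forall>t\<ge>0. assoc_fun M t = ereal (\<omega> t)) \<and> general_weight_function \<omega>) \<and>
           (\<exists>Q::nat. Q \<ge> 2 \<and>
             1 < liminf (\<lambda>j. ereal (quot M (Q * j) / quot M j)) \<and>
             liminf (\<lambda>j. ereal (quot M (Q * j) / quot M j))
               \<le> limsup (\<lambda>j. ereal (quot M (Q * j) / quot M j)) \<and>
             limsup (\<lambda>j. ereal (quot M (Q * j) / quot M j)) < \<infinity>) \<and>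
           moderate_growth M \<and>
           liminf (\<lambda>p. ereal ((M p / N p) powr (1 / real p))) = 0 \<and>
           limsup (\<lambda>p. ereal ((M p / N p) powr (1 / real p))) = \<infinity> \<and>
           \<not> M \<preceq> N \<and> \<not> N \<preceq> M"
proof -
  note N = assms(1)
  obtain Q :: nat where Q: "1 \<le> Q"
    and Qlim: "1 < liminf (\<lambda>j. ereal (quot N (Q * j) / quot N j))"
    and sup: "(SUP j\<in>{1..}. ereal (quot N (2 * j) / quot N j)) < \<infinity>"
    using assms(2) by blast
  have mono: "quot N i \<le> quot N j" if "1 \<le> i" "i \<le> j" for i j
    by (rule LC_quot_mono[OF N that])
  have pos: "0 < quot N i" for i using LC_pos[OF N] by (simp add: quot_def)
  obtain q where q: "1 < ereal q" "ereal q < liminf (\<lambda>j. ereal (quot N (Q * j) / quot N j))"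
    using ereal_dense2[OF Qlim] by blast
  obtain n where n: "\<And>j. n \<le> j \<Longrightarrow> q < quot N (Q * j) / quot N j"
    using less_LiminfD[OF q(2)] by (auto simp: eventually_sequentially)
  have step: "q * quot N j \<le> quot N (Q * j)" if "max n 1 \<le> j" for j
    using n[of j] that pos[of j] by (simp add: field_simps)
  \<comment> \<open>for \<open>Q = 1\<close> the limes inferior would be \<open>1\<close>\<close>
  have "Q \<noteq> 1"
    using step[of "max n 1"] q(1) pos[of "max n 1"] by auto
  with Q have "2 \<le> Q" by simp
  obtain \<epsilon> c where \<epsilon>: "0 < \<epsilon>" and c: "0 < c"
    and lower: "\<And>i j. 1 \<le> i \<Longrightarrow> i \<le> j \<Longrightarrow> c * (real j / real i) powr \<epsilon> * quot N i \<le> quot N j"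
    using power_lower_bound[where \<nu> = "quot N" and ?j0.0 = "max n 1", OF mono pos \<open>2 \<le> Q\<close> _ _ step] q(1) by auto
  obtain D where D: "(SUP j\<in>{1..}. ereal (quot N (2 * j) / quot N j)) < ereal D"
    using ereal_dense2[OF sup] by blast
  have doubling: "quot N (2 * j) \<le> D * quot N j" if "1 \<le> j" for j
  proof -
    have "ereal (quot N (2 * j) / quot N j) \<le> (SUP j\<in>{1..}. ereal (quot N (2 * j) / quot N j))"
      using that by (intro SUP_upper) auto
    from le_less_trans[OF this D] show ?thesis using pos[of j] by (simp add: field_simps)
  qed
  obtain \<mu> B where reg: "regular_quotients \<mu> (c\<^sup>2) (\<epsilon> / 2) B"
    and dev: "\<And>k. 1 \<le> k \<Longrightarrow>
      \<bar>ln (\<mu> k) - ln (quot N k) - \<epsilon> / 4 * osc (ln (real k))\<bar> \<le> \<bar>ln c\<bar>"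
    using oscillating_perturbation[where \<nu> = "quot N", OF mono LC_quot_ge_one[OF N] \<epsilon> c lower doubling] by blast
  interpret regular_quotients \<mu> "c\<^sup>2" "\<epsilon> / 2" B by (rule reg)
  have "\<bar>ln (M p) - ln (N p) - real p * (\<epsilon> / 4 * osc (ln (real p)))\<bar>
      \<le> real p * (\<bar>ln c\<bar> + 2 * (\<epsilon> / 4))" for p
    using average_osc_ln[OF dev, of p] \<epsilon>
    unfolding ln_M LC_ln_eq_sum[OF N] sum_subtractf by simp
  note limits = root_limits_of_oscillation[OF M_pos LC_pos[OF N] _ this]
  have liminf: "liminf (\<lambda>p. ereal ((M p / N p) powr (1 / real p))) = 0"
    and limsup: "limsup (\<lambda>p. ereal ((M p / N p) powr (1 / real p))) = \<infinity>"
    using limits \<epsilon> by simp_all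
  have "\<not> M \<preceq> N"
    using limsup_root_finite_if_preceq[of M N] M_pos LC_pos[OF N] limsup by auto
  moreover have "\<not> N \<preceq> M"
    using liminf_root_pos_if_preceq[of M N] M_pos LC_pos[OF N] liminf by auto
  ultimately show ?thesis
    using M_in_LC assoc_fun_eq_omega omega_general_weight_function quot_dilation_limits
      M_moderate_growth liminf limsup by blast
qed

end
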